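(* Let $\beta>-1$ and $c>0$. Let $P_n^{(0,1)}$ be the monic orthogonal polynomials with respect to the weight $$\rho(x)=\frac{1}{(\beta+1)_x}\frac{c^x}{x!},\qquad x\in\mathbb{N}_0$$ (generalized Charlier polynomials). For $\alpha>0$ let $P_{n,\alpha}^{(1,1)}$ be the monic orthogonal polynomials with respect to $$\rho_\alpha(x)=\frac{(\alpha)_x}{(\beta+1)_x}\frac{(c/\alpha)^x}{x!},\qquad x\in\mathbb{N}_0$$ (generalized Meixner polynomials with parameters $\alpha,\beta$ and $c/\alpha$). Then for every $n\in\mathbb{N}_0$ and every $x$, $$\lim_{\alpha\to\infty}P_{n,\alpha}^{(1,1)}(x)=P_n^{(0,1)}(x).$$
   Context: $(a)_x=a(a+1)\cdots(a+x-1)$, $(a)_0=1$, is the Pochhammer symbol, and $\mathbb{N}_0$ is the set of nonnegative integers. Given a positive weight $\rho$ with finite moments on $\mathbb{N}_0$, the monic orthogonal polynomials $P_n$ with respect to $\rho$ are the monic polynomials of degree $n$ satisfying $\sum_{x=0}^\infty P_n(x)x^k\rho(x)=0$ for $0\le k<n$. *)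

theory Defs
  imports "HOL-Analysis.Analysis" "HOL-Computational_Algebra.Polynomial" "HOL-Real_Asymp.Real_Asymp"
begin

definition gen_charlier_weight :: "real \<Rightarrow> real \<Rightarrow> nat \<Rightarrow> real" where
  "gen_charlier_weight \<beta> c x = 1 / pochhammer (\<beta> + 1) x * (c ^ x / fact x)"

definition gen_meixner_weight :: "real \<Rightarrow> real \<Rightarrow> real \<Rightarrow> nat \<Rightarrow> real" where
  "gen_meixner_weight \<alpha> \<beta> a x = pochhammer \<alpha> x / pochhammer (\<beta> + 1) x * (a ^ x / fact x)"

text \<open>Using \<open>sums\<close> instead of \<open>suminf\<close> makes convergence of the orthogonality sums part of
  the definition.\<close>

definition is_monic_orthogonal_poly :: "(nat \<Rightarrow> real) \<Rightarrow> nat \<Rightarrow> real poly \<Rightarrow> bool" where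
  "is_monic_orthogonal_poly \<rho> n p \<longleftrightarrow>
     degree p = n \<and> lead_coeff p = 1 \<and>
     (\<forall>k<n. (\<lambda>x. poly p (of_nat x) * of_nat x ^ k * \<rho> x) sums 0)"

text \<open>The description is well defined for every positive weight with finite moments, see
  \<open>ex1_monic_orthogonal_poly\<close> below, and the two weights above are of this kind.\<close>

definition monic_orthogonal_poly :: "(nat \<Rightarrow> real) \<Rightarrow> nat \<Rightarrow> real poly" where
  "monic_orthogonal_poly \<rho> n = (THE p. is_monic_orthogonal_poly \<rho> n p)"

definition positive_weight_finite_moments :: "(nat \<Rightarrow> real) \<Rightarrow> bool" where
  "positive_weight_finite_moments \<rho> \<longleftrightarrow>
     (\<forall>x. 0 < \<rho> x) \<and> (\<forall>k. summable (\<lambda>x. real x ^ k * \<rho> x))"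

lemma summable_poly_weight:
  assumes "positive_weight_finite_moments \<rho>"
  shows "summable (\<lambda>x. poly p (real x) * \<rho> x)"
proof -
  have "summable (\<lambda>x. \<Sum>i\<le>degree p. coeff p i * (real x ^ i * \<rho> x))"
    using assms unfolding positive_weight_finite_moments_def
    by (intro summable_sum summable_mult) auto
  thus ?thesis by (simp add: poly_altdef sum_distrib_right mult.assoc)
qed

lemma orthogonal_to_lower_degree:
  assumes "is_monic_orthogonal_poly \<rho> n p" "r = 0 \<or> degree r < n"
  shows "(\<lambda>x. poly p (real x) * poly r (real x) * \<rho> x) sums 0"
proof (cases "r = 0")
  case False
  hence d: "degree r < n" using assms by auto
  have "(\<lambda>x. \<Sum>i\<le>degree r. coeff r i * (poly p (real x) * real x ^ i * \<rho> x))
          sums (\<Sum>i\<le>degree r. coeff r i * 0)"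
    using assms(1) d unfolding is_monic_orthogonal_poly_def
    by (intro sums_sum sums_mult) auto
  moreover have "(\<Sum>i\<le>degree r. coeff r i * (poly p (real x) * real x ^ i * \<rho> x))
      = poly p (real x) * poly r (real x) * \<rho> x" for x
    by (simp add: poly_altdef[of r] sum_distrib_left sum_distrib_right mult_ac)
  ultimately show ?thesis by simp
qed simp

lemma sum_square_pos:
  assumes w: "positive_weight_finite_moments \<rho>" and "p \<noteq> 0"
  shows "0 < (\<Sum>x. poly p (real x) * poly p (real x) * \<rho> x)"
proof -
  have inf: "infinite (range real)"
    using finite_imageD infinite_UNIV_nat inj_of_nat by blast
  have "finite {z. poly p z = 0}" using \<open>p \<noteq> 0\<close> poly_roots_finite by blast
  with inf obtain x where x: "poly p (real x) \<noteq> 0"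
    by (metis (mono_tags, lifting) finite_subset image_subset_iff mem_Collect_eq)
  have pos: "\<And>x. 0 < \<rho> x" using w by (auto simp: positive_weight_finite_moments_def)
  have s: "summable (\<lambda>x. poly p (real x) * poly p (real x) * \<rho> x)"
    using summable_poly_weight[OF w, of "p * p"] by simp
  show ?thesis
    by (rule suminf_pos2[OF s, of x]) (use x pos in \<open>auto simp: less_imp_le zero_less_mult_iff linorder_neq_iff\<close>)
qed

lemma degree_diff_monic:
  fixes p q :: "real poly"
  assumes "degree p = n" "degree q = n" "lead_coeff p = 1" "lead_coeff q = 1"
  shows "p - q = 0 \<or> degree (p - q) < n"
proof (rule ccontr)
  assume "\<not> ?thesis"
  moreover have "degree (p - q) \<le> n" using assms by (simp add: degree_diff_le)
  ultimately have "p - q \<noteq> 0" "degree (p - q) = n" by auto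
  moreover have "coeff (p - q) n = 0" using assms by simp
  ultimately show False using leading_coeff_0_iff by metis
qed

lemma ex_monic_orthogonal_poly:
  assumes w: "positive_weight_finite_moments \<rho>"
  shows "\<exists>p. is_monic_orthogonal_poly \<rho> n p"
proof (induction n rule: less_induct)
  case (less n)
  have "m \<le> n \<Longrightarrow> \<exists>p. degree p = n \<and> lead_coeff p = 1 \<and>
     (\<forall>k<m. (\<lambda>x. poly p (real x) * real x ^ k * \<rho> x) sums 0)" for m
  proof (induction m)
    case 0
    show ?case by (rule exI[of _ "monom 1 n"]) (simp add: degree_monom_eq)
  next
    case (Suc m)
    then obtain p where p: "degree p = n" "lead_coeff p = 1"
      "\<And>k. k < m \<Longrightarrow> (\<lambda>x. poly p (real x) * real x ^ k * \<rho> x) sums 0" by auto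
    from Suc less obtain q where q: "is_monic_orthogonal_poly \<rho> m q" by force
    define A where "A f = (\<Sum>x. poly f (real x) * real x ^ m * \<rho> x)" for f
    have A: "(\<lambda>x. poly f (real x) * real x ^ m * \<rho> x) sums A f" for f
      using summable_poly_weight[OF w, of "f * monom 1 m"] unfolding A_def
      by (simp add: poly_monom summable_sums mult_ac)
    have qm: "degree q = m" "lead_coeff q = 1" using q by (auto simp: is_monic_orthogonal_poly_def)
    have "q - monom 1 m = 0 \<or> degree (q - monom 1 m) < m"
      using qm by (intro degree_diff_monic) (auto simp: degree_monom_eq)
    from sums_add[OF orthogonal_to_lower_degree[OF q this] A[of q]]
    have "(\<lambda>x. poly q (real x) * poly q (real x) * \<rho> x) sums A q"
      by (simp add: poly_monom algebra_simps)
    moreover have "q \<noteq> 0" using qm by auto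
    ultimately have Aq: "A q > 0" using sum_square_pos[OF w, of q] by (simp add: sums_iff)
    define r where "r = smult (A p / A q) q"
    have dr: "degree r < n" using qm Suc.prems by (auto simp: r_def)
    have co: "coeff (p - r) n = 1" using dr p by (simp add: coeff_eq_0)
    have "degree (p - r) \<le> n" using dr p by (simp add: degree_diff_le)
    hence dpr: "degree (p - r) = n" using co by (metis le_antisym le_degree zero_neq_one)
    have "(\<lambda>x. poly (p - r) (real x) * real x ^ k * \<rho> x) sums 0" if "k < Suc m" for k
    proof -
      have eq: "poly (p - r) (real x) * real x ^ k * \<rho> x =
        poly p (real x) * real x ^ k * \<rho> x - A p / A q * (poly q (real x) * real x ^ k * \<rho> x)" for x
        by (simp add: r_def algebra_simps)
      show ?thesis
      proof (cases "k = m")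
        case True
        show ?thesis
          unfolding eq using sums_diff[OF A[of p] sums_mult[OF A[of q], of "A p / A q"]] Aq True by simp
      next
        case False
        hence "k < m" using that by simp
        hence "(\<lambda>x. poly q (real x) * real x ^ k * \<rho> x) sums 0"
          using q by (auto simp: is_monic_orthogonal_poly_def)
        from sums_diff[OF p(3)[OF \<open>k < m\<close>] sums_mult[OF this, of "A p / A q"]]
        show ?thesis unfolding eq by simp
      qed
    qed
    with dpr co show ?case by metis
  qed
  from this[of n] show ?case by (auto simp: is_monic_orthogonal_poly_def)
qed

lemma monic_orthogonal_poly_unique:
  assumes w: "positive_weight_finite_moments \<rho>"
    and p: "is_monic_orthogonal_poly \<rho> n p" and q: "is_monic_orthogonal_poly \<rho> n q"
  shows "p = q"
proof (rule ccontr)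
  assume "p \<noteq> q"
  have d: "p - q = 0 \<or> degree (p - q) < n"
    using p q by (intro degree_diff_monic) (auto simp: is_monic_orthogonal_poly_def)
  from sums_diff[OF orthogonal_to_lower_degree[OF p d] orthogonal_to_lower_degree[OF q d]]
  have "(\<lambda>x. poly (p - q) (real x) * poly (p - q) (real x) * \<rho> x) sums 0"
    by (simp add: algebra_simps)
  with sum_square_pos[OF w, of "p - q"] \<open>p \<noteq> q\<close> show False by (simp add: sums_iff)
qed

lemma ex1_monic_orthogonal_poly:
  assumes "positive_weight_finite_moments \<rho>"
  shows "\<exists>!p. is_monic_orthogonal_poly \<rho> n p"
  using ex_monic_orthogonal_poly[OF assms] monic_orthogonal_poly_unique[OF assms] by blast

lemma is_monic_orthogonal_poly_monic_orthogonal_poly: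
  assumes "positive_weight_finite_moments \<rho>"
  shows "is_monic_orthogonal_poly \<rho> n (monic_orthogonal_poly \<rho> n)"
  unfolding monic_orthogonal_poly_def by (rule theI'[OF ex1_monic_orthogonal_poly[OF assms]])

lemma finite_moments_ratio:
  fixes \<rho> :: "nat \<Rightarrow> real"
  assumes pos: "\<And>x. 0 < \<rho> x" and lim: "(\<lambda>x. \<rho> (Suc x) / \<rho> x) \<longlonglongrightarrow> 0"
  shows "positive_weight_finite_moments \<rho>"
proof -
  have "summable (\<lambda>x. real x ^ k * \<rho> x)" for k
  proof -
    have "(\<lambda>x. real (Suc x) / real x) \<longlonglongrightarrow> 1"
      by (rule LIMSEQ_Suc_n_over_n)
    hence "(\<lambda>x. (real (Suc x) / real x) ^ k * (\<rho> (Suc x) / \<rho> x)) \<longlonglongrightarrow> 1 ^ k * 0"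
      by (intro tendsto_intros lim)
    hence "eventually (\<lambda>x. (real (Suc x) / real x) ^ k * (\<rho> (Suc x) / \<rho> x) < 1/2) sequentially"
      by (rule order_tendstoD) simp
    with eventually_gt_at_top[of 0]
    have "eventually (\<lambda>x. norm (real (Suc x) ^ k * \<rho> (Suc x)) \<le> 1/2 * norm (real x ^ k * \<rho> x)) sequentially"
    proof eventually_elim
      case (elim x)
      hence "real (Suc x) ^ k * \<rho> (Suc x) \<le> 1/2 * (real x ^ k * \<rho> x)"
        using pos[of x] by (simp add: power_divide field_simps)
      thus ?case using pos[of x] pos[of "Suc x"] by (simp add: abs_mult)
    qed
    then obtain N where
      "\<And>x. x \<ge> N \<Longrightarrow> norm (real (Suc x) ^ k * \<rho> (Suc x)) \<le> 1/2 * norm (real x ^ k * \<rho> x)"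
      by (auto simp: eventually_at_top_linorder)
    thus ?thesis by (intro summable_ratio_test[of "1/2"]) auto
  qed
  with pos show ?thesis by (simp add: positive_weight_finite_moments_def)
qed

lemma gen_charlier_weight_admissible:
  assumes "\<beta> > -1" "c > 0"
  shows "positive_weight_finite_moments (gen_charlier_weight \<beta> c)"
proof (rule finite_moments_ratio)
  have p: "pochhammer (\<beta> + 1) x > 0" for x using assms by (intro pochhammer_pos) auto
  show "0 < gen_charlier_weight \<beta> c x" for x
    using assms p by (simp add: gen_charlier_weight_def)
  have "(\<lambda>x. c / ((\<beta> + 1 + real x) * (real x + 1))) \<longlonglongrightarrow> 0"
    by real_asymp
  moreover have "gen_charlier_weight \<beta> c (Suc x) / gen_charlier_weight \<beta> c x =
      c / ((\<beta> + 1 + real x) * (real x + 1))" for x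
    using assms p[of x] by (simp add: gen_charlier_weight_def pochhammer_Suc divide_simps)
  ultimately show "(\<lambda>x. gen_charlier_weight \<beta> c (Suc x) / gen_charlier_weight \<beta> c x) \<longlonglongrightarrow> 0"
    by simp
qed

lemma gen_meixner_weight_admissible:
  assumes "\<alpha> > 0" "\<beta> > -1" "a > 0"
  shows "positive_weight_finite_moments (gen_meixner_weight \<alpha> \<beta> a)"
proof (rule finite_moments_ratio)
  have p: "pochhammer (\<beta> + 1) x > 0" "pochhammer \<alpha> x > 0" for x
    using assms by (auto intro!: pochhammer_pos)
  show "0 < gen_meixner_weight \<alpha> \<beta> a x" for x
    using assms p by (simp add: gen_meixner_weight_def)
  have "(\<lambda>x. (\<alpha> + real x) * a / ((\<beta> + 1 + real x) * (real x + 1))) \<longlonglongrightarrow> 0"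
    by real_asymp
  moreover have "gen_meixner_weight \<alpha> \<beta> a (Suc x) / gen_meixner_weight \<alpha> \<beta> a x =
      (\<alpha> + real x) * a / ((\<beta> + 1 + real x) * (real x + 1))" for x
    using assms p[of x] by (simp add: gen_meixner_weight_def pochhammer_Suc divide_simps)
  ultimately show "(\<lambda>x. gen_meixner_weight \<alpha> \<beta> a (Suc x) / gen_meixner_weight \<alpha> \<beta> a x) \<longlonglongrightarrow> 0"
    by simp
qed

end

theory Submission
  imports Defs
begin

text \<open>By Gram--Schmidt, the coefficients of \<open>P\<^sub>n\<close> are continuous functions of the coefficients
  of \<open>P\<^sub>0, \<dots>, P\<^sub>n\<^sub>-\<^sub>1\<close> and of the moments of the weight. It is therefore enough that
  the moments converge. They do by dominated convergence: \<open>(\<alpha>)\<^sub>x / \<alpha>\<^sup>x\<close> is the product of the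
  factors \<open>1 + i / \<alpha>\<close> with \<open>i < x\<close>, so it tends to \<open>1\<close> and, for \<open>\<alpha> \<ge> 1\<close>, is at most
  its value at \<open>\<alpha> = 1\<close>.\<close>

section \<open>Weights as linear functionals on polynomials\<close>

text \<open>The moment functional of the weight. It is a total function built with
  \<open>suminf\<close>, so its values can appear in quotients; linearity relies on convergence of
  the series, hence the assumption of finite moments in the rules below.\<close>

definition weight_functional :: "(nat \<Rightarrow> real) \<Rightarrow> real poly \<Rightarrow> real" where
  "weight_functional \<rho> p = (\<Sum>x. poly p (real x) * \<rho> x)"

lemma weight_functional_diff:
  assumes "positive_weight_finite_moments \<rho>"
  shows "weight_functional \<rho> (p - q) = weight_functional \<rho> p - weight_functional \<rho> q"
  using suminf_diff[OF summable_poly_weight[OF assms, of p] summable_poly_weight[OF assms, of q]]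
  by (simp add: weight_functional_def left_diff_distrib)

lemma weight_functional_smult:
  assumes "positive_weight_finite_moments \<rho>"
  shows "weight_functional \<rho> (smult a p) = a * weight_functional \<rho> p"
  using suminf_mult[OF summable_poly_weight[OF assms, of p], of a]
  by (simp add: weight_functional_def mult.assoc)

lemma weight_functional_sum:
  assumes "positive_weight_finite_moments \<rho>"
  shows "weight_functional \<rho> (\<Sum>i\<in>I. f i) = (\<Sum>i\<in>I. weight_functional \<rho> (f i))"
  using suminf_sum[of I "\<lambda>i x. poly (f i) (real x) * \<rho> x"] summable_poly_weight[OF assms]
  by (simp add: weight_functional_def poly_sum sum_distrib_right)

text \<open>A bound \<open>N\<close> in place of the degree gives one index range for a whole family
  of polynomials, as needed for taking limits term by term.\<close>

lemma poly_altdef_bound: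
  fixes p :: "'a :: comm_semiring_1 poly"
  assumes "degree p \<le> N"
  shows "poly p x = (\<Sum>i\<le>N. coeff p i * x ^ i)"
  unfolding poly_altdef using assms by (intro sum.mono_neutral_left) (auto simp: coeff_eq_0)

lemma weight_functional_moments:
  assumes "positive_weight_finite_moments \<rho>" "degree p \<le> N"
  shows "weight_functional \<rho> p = (\<Sum>i\<le>N. coeff p i * (\<Sum>x. real x ^ i * \<rho> x))"
proof -
  have "weight_functional \<rho> p = (\<Sum>x. \<Sum>i\<le>N. coeff p i * (real x ^ i * \<rho> x))"
    using assms(2)
    by (simp add: weight_functional_def poly_altdef_bound sum_distrib_right mult.assoc)
  also have "\<dots> = (\<Sum>i\<le>N. coeff p i * (\<Sum>x. real x ^ i * \<rho> x))"
    using assms(1) unfolding positive_weight_finite_moments_def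
    by (subst suminf_sum) (auto intro!: summable_mult sum.cong suminf_mult)
  finally show ?thesis .
qed

section \<open>Orthogonality and the Gram-Schmidt formula\<close>

lemma
  assumes "positive_weight_finite_moments \<rho>"
  shows degree_monic_orthogonal_poly: "degree (monic_orthogonal_poly \<rho> n) = n"
    and coeff_monic_orthogonal_poly: "coeff (monic_orthogonal_poly \<rho> n) n = 1"
  using is_monic_orthogonal_poly_monic_orthogonal_poly[OF assms, of n]
  by (auto simp: is_monic_orthogonal_poly_def)

lemma weight_functional_orthogonal:
  assumes "positive_weight_finite_moments \<rho>" "r = 0 \<or> degree r < n"
  shows "weight_functional \<rho> (monic_orthogonal_poly \<rho> n * r) = 0"
  using orthogonal_to_lower_degree[OF is_monic_orthogonal_poly_monic_orthogonal_poly[OF assms(1)] assms(2)]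
  by (simp add: weight_functional_def sums_iff)

text \<open>The polynomial with the larger index is orthogonal to the other one, whose degree is
  smaller.\<close>

lemma weight_functional_orthogonal_pair:
  assumes "positive_weight_finite_moments \<rho>" "i \<noteq> j"
  shows "weight_functional \<rho> (monic_orthogonal_poly \<rho> i * monic_orthogonal_poly \<rho> j) = 0"
proof (cases "i < j")
  case True
  then show ?thesis
    using weight_functional_orthogonal[OF assms(1), of "monic_orthogonal_poly \<rho> i" j]
    by (simp add: degree_monic_orthogonal_poly[OF assms(1)] mult.commute)
next
  case False
  then show ?thesis
    using weight_functional_orthogonal[OF assms(1), of "monic_orthogonal_poly \<rho> j" i] assms(2)
    by (simp add: degree_monic_orthogonal_poly[OF assms(1)])
qed

lemma weight_functional_square_pos:
  assumes "positive_weight_finite_moments \<rho>" "p \<noteq> 0"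
  shows "weight_functional \<rho> (p * p) > 0"
  using sum_square_pos[OF assms] by (simp add: weight_functional_def)

lemma monic_orthogonal_poly_nonzero:
  assumes "positive_weight_finite_moments \<rho>"
  shows "monic_orthogonal_poly \<rho> n \<noteq> 0"
  using coeff_monic_orthogonal_poly[OF assms, of n] by auto

text \<open>If \<open>d\<close> were nonzero of degree \<open>j\<close>, then \<open>d\<close>
  divided by its leading coefficient would differ from the monic \<open>P\<close> of degree
  \<open>j\<close> by a polynomial of lower degree, which is orthogonal to \<open>P\<close>. Pairing
  with \<open>P\<close> would then give the positive square norm of \<open>P\<close>, although
  \<open>d\<close> is orthogonal to \<open>P\<close>.\<close>

lemma orthogonal_to_all_lower_imp_zero:
  assumes w: "positive_weight_finite_moments \<rho>"
    and deg: "d = 0 \<or> degree d < n"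
    and orth: "\<And>m. m < n \<Longrightarrow> weight_functional \<rho> (monic_orthogonal_poly \<rho> m * d) = 0"
  shows "d = 0"
proof (rule ccontr)
  assume "d \<noteq> 0"
  define j P where "j = degree d" and "P = monic_orthogonal_poly \<rho> j"
  let ?a = "lead_coeff d"
  have "j < n" using deg \<open>d \<noteq> 0\<close> by (simp add: j_def)
  have P: "degree P = j" "coeff P j = 1"
    using w by (simp_all add: P_def degree_monic_orthogonal_poly coeff_monic_orthogonal_poly)
  let ?r = "smult (inverse ?a) d - P"
  have "?r = 0 \<or> degree ?r < j"
    by (rule degree_diff_monic) (use P \<open>d \<noteq> 0\<close> in \<open>auto simp: j_def\<close>)
  hence "weight_functional \<rho> (P * ?r) = 0"
    unfolding P_def by (rule weight_functional_orthogonal[OF w])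
  hence "inverse ?a * weight_functional \<rho> (P * d) = weight_functional \<rho> (P * P)"
    by (simp add: right_diff_distrib weight_functional_diff[OF w] weight_functional_smult[OF w])
  moreover have "weight_functional \<rho> (P * P) > 0"
    unfolding P_def by (intro weight_functional_square_pos monic_orthogonal_poly_nonzero w)
  ultimately show False using orth[OF \<open>j < n\<close>] by (simp add: P_def)
qed

text \<open>Both sides are monic of degree \<open>n\<close>, so their difference has lower degree.
  It is also orthogonal to every \<open>P m\<close> with \<open>m < n\<close>, because the
  coefficients are those of the projection of \<open>monom 1 n\<close>; hence it vanishes.\<close>

lemma monic_orthogonal_poly_gram_schmidt:
  fixes \<rho> n
  defines "P \<equiv> monic_orthogonal_poly \<rho>"
  assumes w: "positive_weight_finite_moments \<rho>"
  shows "P n = monom 1 n - (\<Sum>m<n. smult (weight_functional \<rho> (P m * monom 1 n) /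
    weight_functional \<rho> (P m * P m)) (P m))"
proof -
  define a where "a m = weight_functional \<rho> (P m * monom 1 n) / weight_functional \<rho> (P m * P m)" for m
  define s where "s = (\<Sum>m<n. smult (a m) (P m))"
  have degP: "degree (P m) = m" and coeffP: "coeff (P m) m = 1" for m
    using w by (simp_all add: P_def degree_monic_orthogonal_poly coeff_monic_orthogonal_poly)
  \<comment> \<open>The alternative \<open>s = 0\<close> covers \<open>n = 0\<close>, where the sum
    is empty and no degree is below \<open>n\<close>.\<close>
  have deg_s: "s = 0 \<or> degree s < n"
  proof (cases "n = 0")
    case False
    have "degree s \<le> n - 1"
      unfolding s_def using degP
      by (intro degree_sum_le) (auto intro: order.trans[OF degree_smult_le])
    with False show ?thesis by linarith
  qed (simp add: s_def)
  have "P n - monom 1 n = 0 \<or> degree (P n - monom 1 n) < n"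
    using degP coeffP by (intro degree_diff_monic) (auto simp: degree_monom_eq)
  with deg_s have "P n - monom 1 n + s = 0 \<or> degree (P n - monom 1 n + s) < n"
    by (metis add.left_neutral add.right_neutral degree_add_less)
  hence "P n - (monom 1 n - s) = 0 \<or> degree (P n - (monom 1 n - s)) < n"
    by (simp add: algebra_simps)
  hence "P n - (monom 1 n - s) = 0"
  proof (rule orthogonal_to_all_lower_imp_zero[OF w], fold P_def)
    fix m assume "m < n"
    have pos: "weight_functional \<rho> (P m * P m) > 0"
      unfolding P_def by (intro weight_functional_square_pos monic_orthogonal_poly_nonzero w)
    have "weight_functional \<rho> (P m * s) =
        (\<Sum>i<n. a i * weight_functional \<rho> (P m * P i))"
      by (simp add: s_def sum_distrib_left weight_functional_sum[OF w] weight_functional_smult[OF w])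
    \<comment> \<open>Only \<open>i = m\<close> survives by orthogonality, and there the denominator
      of \<open>a m\<close> cancels.\<close>
    also have "\<dots> = (\<Sum>i<n. if i = m then weight_functional \<rho> (P m * monom 1 n) else 0)"
      using pos weight_functional_orthogonal_pair[OF w]
      by (intro sum.cong) (auto simp: a_def P_def)
    also have "\<dots> = weight_functional \<rho> (P m * monom 1 n)"
      using \<open>m < n\<close> by simp
    finally have "weight_functional \<rho> (P m * s) = weight_functional \<rho> (P m * monom 1 n)" .
    moreover have "weight_functional \<rho> (P m * P n) = 0"
      using weight_functional_orthogonal_pair[OF w, of m n] \<open>m < n\<close> by (simp add: P_def)
    ultimately show "weight_functional \<rho> (P m * (P n - (monom 1 n - s))) = 0"
      by (simp add: right_diff_distrib weight_functional_diff[OF w])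
  qed
  thus ?thesis by (simp add: s_def a_def)
qed

section \<open>Continuity in the moments\<close>

text \<open>The common degree bound \<open>N\<close> turns the functional into a sum of
  \<open>N + 1\<close> products of a coefficient and a moment, and each factor converges.\<close>

lemma tendsto_weight_functional:
  assumes "eventually (\<lambda>t. positive_weight_finite_moments (\<rho> t)) F"
    and "positive_weight_finite_moments \<rho>'"
    and "\<And>k. ((\<lambda>t. \<Sum>x. real x ^ k * \<rho> t x) \<longlongrightarrow> (\<Sum>x. real x ^ k * \<rho>' x)) F"
    and "\<And>k. ((\<lambda>t. coeff (p t) k) \<longlongrightarrow> coeff q k) F"
    and "eventually (\<lambda>t. degree (p t) \<le> N) F" "degree q \<le> N"
  shows "((\<lambda>t. weight_functional (\<rho> t) (p t)) \<longlongrightarrow> weight_functional \<rho>' q) F"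
proof -
  have "((\<lambda>t. \<Sum>i\<le>N. coeff (p t) i * (\<Sum>x. real x ^ i * \<rho> t x)) \<longlongrightarrow>
      (\<Sum>i\<le>N. coeff q i * (\<Sum>x. real x ^ i * \<rho>' x))) F"
    by (intro tendsto_intros assms)
  moreover have "eventually (\<lambda>t. (\<Sum>i\<le>N. coeff (p t) i * (\<Sum>x. real x ^ i * \<rho> t x)) =
      weight_functional (\<rho> t) (p t)) F"
    using assms(1,5) by eventually_elim (simp add: weight_functional_moments)
  ultimately show ?thesis
    using assms(2,6) by (simp add: weight_functional_moments tendsto_cong)
qed

text \<open>Strong induction on \<open>n\<close>: the Gram-Schmidt formula builds the coefficients
  from earlier polynomials and from values of the functional, all of which converge.\<close>

lemma tendsto_coeff_monic_orthogonal_poly: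
  assumes w: "eventually (\<lambda>t. positive_weight_finite_moments (\<rho> t)) F"
    and w': "positive_weight_finite_moments \<rho>'"
    and moments: "\<And>k. ((\<lambda>t. \<Sum>x. real x ^ k * \<rho> t x) \<longlongrightarrow> (\<Sum>x. real x ^ k * \<rho>' x)) F"
  shows "((\<lambda>t. coeff (monic_orthogonal_poly (\<rho> t) n) k) \<longlongrightarrow>
    coeff (monic_orthogonal_poly \<rho>' n) k) F"
proof (induction n arbitrary: k rule: less_induct)
  case (less n)
  define P P' where "P t = monic_orthogonal_poly (\<rho> t)" and "P' = monic_orthogonal_poly \<rho>'" for t
  have P: "((\<lambda>t. coeff (P t m) k) \<longlongrightarrow> coeff (P' m) k) F" if "m < n" for m k
    using less[OF that] by (simp add: P_def P'_def)
  have degP': "degree (P' m) = m" for m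
    using w' by (simp add: P'_def degree_monic_orthogonal_poly)
  have degP: "eventually (\<lambda>t. degree (P t m) = m) F" for m
    using w by eventually_elim (simp add: P_def degree_monic_orthogonal_poly)
  have lin: "((\<lambda>t. weight_functional (\<rho> t) (P t m * monom 1 n)) \<longlongrightarrow>
      weight_functional \<rho>' (P' m * monom 1 n)) F" if "m < n" for m
  proof (rule tendsto_weight_functional[OF w w' moments])
    show "((\<lambda>t. coeff (P t m * monom 1 n) k) \<longlongrightarrow> coeff (P' m * monom 1 n) k) F" for k
      unfolding coeff_mult by (intro tendsto_intros P that)
    show "eventually (\<lambda>t. degree (P t m * monom 1 n) \<le> m + n) F"
      using degP[of m]
      by eventually_elim (metis degree_mult_le degree_monom_eq zero_neq_one)
    show "degree (P' m * monom 1 n) \<le> m + n"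
      by (metis degP' degree_mult_le degree_monom_eq zero_neq_one)
  qed
  have sq: "((\<lambda>t. weight_functional (\<rho> t) (P t m * P t m)) \<longlongrightarrow>
      weight_functional \<rho>' (P' m * P' m)) F" if "m < n" for m
  proof (rule tendsto_weight_functional[OF w w' moments])
    show "((\<lambda>t. coeff (P t m * P t m) k) \<longlongrightarrow> coeff (P' m * P' m) k) F" for k
      unfolding coeff_mult by (intro tendsto_intros P that)
    show "eventually (\<lambda>t. degree (P t m * P t m) \<le> m + m) F"
      using degP[of m] by eventually_elim (metis degree_mult_le)
    show "degree (P' m * P' m) \<le> m + m"
      by (metis degP' degree_mult_le)
  qed
  \<comment> \<open>The limit of each quotient requires a nonzero limit of the denominator, which is
    a square norm for the limit weight.\<close>
  have nz: "weight_functional \<rho>' (P' m * P' m) \<noteq> 0" for m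
    using weight_functional_square_pos[OF w' monic_orthogonal_poly_nonzero[OF w', of m]]
    by (simp add: P'_def)
  have "((\<lambda>t. coeff (monom 1 n) k - (\<Sum>m<n. weight_functional (\<rho> t) (P t m * monom 1 n) /
      weight_functional (\<rho> t) (P t m * P t m) * coeff (P t m) k)) \<longlongrightarrow>
    coeff (monom 1 n) k - (\<Sum>m<n. weight_functional \<rho>' (P' m * monom 1 n) /
      weight_functional \<rho>' (P' m * P' m) * coeff (P' m) k)) F"
    by (intro tendsto_intros lin sq P nz) auto
  moreover have "eventually (\<lambda>t. coeff (monom 1 n) k -
      (\<Sum>m<n. weight_functional (\<rho> t) (P t m * monom 1 n) /
      weight_functional (\<rho> t) (P t m * P t m) * coeff (P t m) k) = coeff (P t n) k) F"
    using w
  proof eventually_elim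
    case (elim t)
    show ?case
      unfolding P_def
      \<comment> \<open>Only the polynomial of degree \<open>n\<close> on the right is expanded;
        those inside the sum stay as they are.\<close>
      by (subst (4) monic_orthogonal_poly_gram_schmidt[OF elim]) (simp add: coeff_sum)
  qed
  moreover have "coeff (monom 1 n) k - (\<Sum>m<n. weight_functional \<rho>' (P' m * monom 1 n) /
      weight_functional \<rho>' (P' m * P' m) * coeff (P' m) k) = coeff (P' n) k"
    unfolding P'_def
    by (subst (4) monic_orthogonal_poly_gram_schmidt[OF w']) (simp add: coeff_sum)
  ultimately show ?case
    by (simp add: P_def P'_def tendsto_cong)
qed

section \<open>Convergence of the Meixner moments\<close>

text \<open>Taking \<alpha> out of each of the \<open>x\<close> factors of the Pochhammer symbol
  cancels the power of \<alpha> in the weight. What remains of \<alpha> is a finite product of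
  factors tending to 1.\<close>

lemma gen_meixner_weight_scaled:
  assumes "\<alpha> > 0"
  shows "gen_meixner_weight \<alpha> \<beta> (c / \<alpha>) x =
    (\<Prod>i<x. 1 + real i / \<alpha>) * gen_charlier_weight \<beta> c x"
proof -
  have "pochhammer \<alpha> x = (\<Prod>i<x. 1 + real i / \<alpha>) * \<alpha> ^ x"
    using assms by (induction x) (auto simp: pochhammer_Suc field_simps)
  thus ?thesis
    using assms by (simp add: gen_meixner_weight_def gen_charlier_weight_def power_divide)
qed

lemma tendsto_gen_meixner_weight:
  "((\<lambda>\<alpha>. gen_meixner_weight \<alpha> \<beta> (c / \<alpha>) x) \<longlongrightarrow> gen_charlier_weight \<beta> c x) at_top"
proof -
  have "((\<lambda>\<alpha>. 1 + real i / \<alpha>) \<longlongrightarrow> 1) at_top" for i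
    by real_asymp
  hence "((\<lambda>\<alpha>. (\<Prod>i<x. 1 + real i / \<alpha>) * gen_charlier_weight \<beta> c x) \<longlongrightarrow>
      (\<Prod>i<x. 1) * gen_charlier_weight \<beta> c x) at_top"
    by (intro tendsto_intros)
  moreover have "eventually (\<lambda>\<alpha>. (\<Prod>i<x. 1 + real i / \<alpha>) * gen_charlier_weight \<beta> c x =
      gen_meixner_weight \<alpha> \<beta> (c / \<alpha>) x) at_top"
    using eventually_gt_at_top[of 0] by eventually_elim (simp add: gen_meixner_weight_scaled)
  ultimately show ?thesis by (simp add: tendsto_cong)
qed

text \<open>Each factor of the product is at most its value at \<alpha> = 1. The majorant is itself
  a generalized Meixner weight, so its moments are already known to be finite.\<close>

lemma gen_meixner_weight_le:
  assumes "\<beta> > -1" "c > 0" "\<alpha> \<ge> 1"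
  shows "gen_meixner_weight \<alpha> \<beta> (c / \<alpha>) x \<le> gen_meixner_weight 1 \<beta> c x"
proof -
  have "gen_charlier_weight \<beta> c x > 0"
    using gen_charlier_weight_admissible[OF assms(1,2)]
    by (simp add: positive_weight_finite_moments_def)
  \<comment> \<open>The division by 1 keeps the form of \<open>gen_meixner_weight_scaled\<close> at
    \<alpha> = 1.\<close>
  moreover have "(\<Prod>i<x. 1 + real i / \<alpha>) \<le> (\<Prod>i<x. 1 + real i / 1)"
    using assms(3) by (intro prod_mono) (auto simp: divide_le_eq mult_le_cancel_left1)
  ultimately show ?thesis
    using gen_meixner_weight_scaled[of \<alpha> \<beta> c x] gen_meixner_weight_scaled[of 1 \<beta> c x] assms(3)
    by (simp add: mult_right_mono)
qed

text \<open>Tannery's theorem, that is dominated convergence for series: the terms converge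
  pointwise, and the terms at \<alpha> = 1 form a summable majorant.\<close>

lemma tendsto_moment_gen_meixner_weight:
  assumes "\<beta> > -1" "c > 0"
  shows "((\<lambda>\<alpha>. \<Sum>x. real x ^ k * gen_meixner_weight \<alpha> \<beta> (c / \<alpha>) x) \<longlongrightarrow>
    (\<Sum>x. real x ^ k * gen_charlier_weight \<beta> c x)) at_top"
proof -
  let ?M = "\<lambda>x. real x ^ k * gen_meixner_weight 1 \<beta> c x"
  have "norm (real x ^ k * gen_meixner_weight \<alpha> \<beta> (c / \<alpha>) x) \<le> ?M x" if "\<alpha> \<ge> 1" for x \<alpha>
  proof -
    have "gen_meixner_weight \<alpha> \<beta> (c / \<alpha>) x > 0"
      using gen_meixner_weight_admissible[of \<alpha> \<beta> "c / \<alpha>"] assms that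
      by (simp add: positive_weight_finite_moments_def)
    thus ?thesis
      using gen_meixner_weight_le[OF assms that, of x] by (simp add: abs_mult mult_left_mono)
  qed
  \<comment> \<open>On the product filter the bound holds for every index \<open>x\<close> as soon
    as \<alpha> \<ge> 1.\<close>
  hence bound: "eventually (\<lambda>(x, \<alpha>). norm (real x ^ k * gen_meixner_weight \<alpha> \<beta> (c / \<alpha>) x) \<le> ?M x)
      (at_top \<times>\<^sub>F at_top)"
    unfolding eventually_prod_filter
    by (intro exI[of _ "\<lambda>_. True"] exI[of _ "\<lambda>\<alpha>. \<alpha> \<ge> 1"]) (auto simp: eventually_ge_at_top)
  have "summable ?M"
    using gen_meixner_weight_admissible[of 1 \<beta> c] assms
    by (simp add: positive_weight_finite_moments_def)
  from tannerys_theorem[OF tendsto_mult_left[OF tendsto_gen_meixner_weight] bound this]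
  show ?thesis by simp
qed

section \<open>From coefficients to values\<close>

theorem mainTheorem4:
  fixes \<beta> c :: real and n :: nat and x :: "'a :: real_normed_field"
  assumes "\<beta> > -1" and "c > 0"
  shows "((\<lambda>\<alpha>. poly (map_poly of_real
             (monic_orthogonal_poly (gen_meixner_weight \<alpha> \<beta> (c / \<alpha>)) n)) x)
          \<longlongrightarrow> poly (map_poly of_real (monic_orthogonal_poly (gen_charlier_weight \<beta> c) n)) x)
         at_top"
proof -
  let ?P = "\<lambda>\<alpha>. monic_orthogonal_poly (gen_meixner_weight \<alpha> \<beta> (c / \<alpha>)) n"
  let ?Q = "monic_orthogonal_poly (gen_charlier_weight \<beta> c) n"
  have w: "positive_weight_finite_moments (gen_meixner_weight \<alpha> \<beta> (c / \<alpha>))" if "\<alpha> > 0" for \<alpha>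
    using assms that by (intro gen_meixner_weight_admissible) auto
  have w': "positive_weight_finite_moments (gen_charlier_weight \<beta> c)"
    by (intro gen_charlier_weight_admissible assms)
  \<comment> \<open>Positivity of the weight is known only for \<alpha> > 0, so it is stated as an
    eventual property at infinity.\<close>
  have ev: "eventually (\<lambda>\<alpha>. positive_weight_finite_moments (gen_meixner_weight \<alpha> \<beta> (c / \<alpha>))) at_top"
    using eventually_gt_at_top[of 0] by eventually_elim (rule w)
  \<comment> \<open>Over the fixed range \<open>i \<le> n\<close>, the value at \<open>x\<close>
    depends continuously on the real coefficients, embedded by \<open>of_real\<close>.\<close>
  have eval: "poly (map_poly of_real (monic_orthogonal_poly \<rho> n)) x =
      (\<Sum>i\<le>n. of_real (coeff (monic_orthogonal_poly \<rho> n) i) * x ^ i)"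
    if "positive_weight_finite_moments \<rho>" for \<rho>
    using that
    by (subst poly_altdef_bound[of _ n])
       (auto simp: coeff_map_poly degree_monic_orthogonal_poly coeff_eq_0 intro!: degree_le)
  have "((\<lambda>\<alpha>. \<Sum>i\<le>n. of_real (coeff (?P \<alpha>) i) * x ^ i) \<longlongrightarrow>
      (\<Sum>i\<le>n. of_real (coeff ?Q i) * x ^ i)) at_top"
    by (intro tendsto_intros tendsto_coeff_monic_orthogonal_poly[OF ev w']
        tendsto_moment_gen_meixner_weight assms)
  moreover have "eventually (\<lambda>\<alpha>. (\<Sum>i\<le>n. of_real (coeff (?P \<alpha>) i) * x ^ i) =
      poly (map_poly of_real (?P \<alpha>)) x) at_top"
    using ev by eventually_elim (simp add: eval)
  ultimately show ?thesis
    by (simp add: eval[OF w'] tendsto_cong)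
qed

end
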